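(* Let $d\ge2$ and let $\omega_1,\dots,\omega_d$ be the $d$-th roots of unity. For $P_0(z)=-\frac1dz^d+a_{d-1}z^{d-1}+\dots+a_1z+a_0\in\mathbb{C}[z]$, put $m_{kl}=\int_0^{+\infty\cdot\omega_l}z^ke^{P_0(z)}\,dz$ for $0\le k\le d-1$, $1\le l\le d$, and let $\Delta=\det(m_{kl})_{1\le l\le d,\ 0\le k\le d-1}$ be the ramificant (rows indexed by $l$, columns by $k$). Then for $j=1,\dots,d-1$, $e^{-a_0}a_j$ is a universal rational function of the $d^2$ quantities $(m_{kl})$. More precisely, $\Delta\,e^{-a_0}a_j$ is a universal polynomial function of degree $d-1$ of the $(m_{kl})$, where universal means that the function depends only on $d$ and $j$, not on $P_0$.
   Context: $\int_0^{+\infty\cdot\omega_l}$ is the integral along the ray from $0$ in the direction $\omega_l$. In the paper's terms, $m_{kl}=f_k(w_l^* )$ is the value of $f_k$ at the $l$-th infinite ramification point of the log-Riemann surface with uniformization $\int_0^ze^{P_0(t)}dt$. *)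

theory Defs
  imports
    "HOL-Analysis.Analysis"
    "HOL-Library.Poly_Mapping"
    "HOL-Computational_Algebra.Polynomial"
    "Jordan_Normal_Form.Determinant"
begin

(* Formal polynomials over the complex numbers in the variables X (k, l): finitely supported
   maps from monomials (themselves finitely supported exponent maps) to coefficients. *)
type_synonym mpoly2 = "((nat \<times> nat) \<Rightarrow>\<^sub>0 nat) \<Rightarrow>\<^sub>0 complex"

definition mpoly_eval :: "(nat \<times> nat \<Rightarrow> complex) \<Rightarrow> mpoly2 \<Rightarrow> complex" where
  "mpoly_eval x p =
     (\<Sum>\<mu>\<in>Poly_Mapping.keys p. Poly_Mapping.lookup p \<mu> *
        (\<Prod>v\<in>Poly_Mapping.keys \<mu>. x v ^ Poly_Mapping.lookup \<mu> v))"

definition mpoly_vars :: "mpoly2 \<Rightarrow> (nat \<times> nat) set" where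
  "mpoly_vars p = (\<Union>\<mu>\<in>Poly_Mapping.keys p. Poly_Mapping.keys \<mu>)"

(* The zero polynomial gets total degree 0. *)
definition mpoly_total_degree :: "mpoly2 \<Rightarrow> nat" where
  "mpoly_total_degree p =
     Max (insert 0 ((\<lambda>\<mu>. \<Sum>v\<in>Poly_Mapping.keys \<mu>. Poly_Mapping.lookup \<mu> v) `
       Poly_Mapping.keys p))"

(* The ray from 0 in the direction w is parametrized by t \<mapsto> t w, so dz = w dt. *)
definition ray_integral :: "complex \<Rightarrow> (complex \<Rightarrow> complex) \<Rightarrow> complex" where
  "ray_integral w f = (LBINT t:{0..}. f (complex_of_real t * w) * w)"

definition ram_moment :: "(nat \<Rightarrow> complex) \<Rightarrow> complex poly \<Rightarrow> nat \<times> nat \<Rightarrow> complex" where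
  "ram_moment \<omega> P = (\<lambda>(k, l). ray_integral (\<omega> l) (\<lambda>z. z ^ k * exp (poly P z)))"

(* Matrix indices start at 0, so row i belongs to the root \<omega> (i + 1). *)
definition ramificant :: "nat \<Rightarrow> (nat \<Rightarrow> complex) \<Rightarrow> complex poly \<Rightarrow> complex" where
  "ramificant d \<omega> P =
     Determinant.det (Matrix.mat d d (\<lambda>(i, k). ram_moment \<omega> P (k, i + 1)))"

definition enumerates_roots_of_unity :: "nat \<Rightarrow> (nat \<Rightarrow> complex) \<Rightarrow> bool" where
  "enumerates_roots_of_unity d \<omega> \<longleftrightarrow> bij_betw \<omega> {1..d} {z. z ^ d = 1}"

definition normalized_poly :: "nat \<Rightarrow> complex poly \<Rightarrow> bool" where
  "normalized_poly d P \<longleftrightarrow> degree P = d \<and> lead_coeff P = - 1 / of_nat d"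

end

theory Submission
  imports Defs
begin

text \<open>
  Integrating the derivative of \<open>e\<^sup>P\<close> along the ray in direction \<open>\<omega> l\<close> gives
  \<open>\<integral> P' e\<^sup>P dz = - exp (a 0)\<close>, because \<open>P(t \<omega> l)\<close> has leading term \<open>- t ^ d / d\<close> and hence
  \<open>e\<^sup>P\<close> vanishes at the end of the ray.  Since \<open>P'\<close> has degree \<open>d - 1\<close>, this says that
  the matrix of moments maps the vector with entries \<open>- exp (- a 0) * coeff (pderiv P) k\<close>, \<open>k < d\<close>,
  to the vector of ones.  Cramer's rule expresses the ramificant times \<open>exp (- a 0) * j * a j\<close> as
  the negative of the determinant of the moment matrix whose column \<open>j - 1\<close> is replaced by ones,
  a form of degree \<open>d - 1\<close> in the moments that does not involve \<open>P\<close>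
  (\<open>ramificant_mult_coeff\<close>).

  Dividing requires that the ramificant never vanishes (\<open>ramificant_nonzero\<close>).  A linear relation
  between the rows of the moment matrix is a functional \<open>Q \<mapsto> \<Sum>l. c l * \<integral> Q e\<^sup>P dz\<close>, the \<open>l\<close>-th integral
  along the \<open>l\<close>-th ray, that kills all \<open>Q\<close> of degree below \<open>d\<close>.  Integration by parts shows that
  it also kills \<open>Q' + Q P'\<close> whenever \<open>Q(0) = 0\<close>; as \<open>P'\<close> has degree \<open>d - 1\<close>, subtracting
  such polynomials lowers every degree below \<open>d\<close>, so the functional kills all polynomials
  (\<open>ray_moments_annihilate_all\<close>).  Let \<open>S\<close> be the polynomial of degree below \<open>d\<close> with
  \<open>P + S = - z ^ d / d\<close>.  Expanding \<open>e\<^sup>S\<close> in its power series under the integral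
  (\<open>ray_moment_sums\<close>) transfers the relation from \<open>P\<close> to \<open>P + S\<close>.  For \<open>P + S\<close>
  the \<open>k\<close>-th moment is \<open>(\<omega> l) ^ (k + 1)\<close> times a positive constant, and distinct
  nonzero numbers satisfy no nontrivial relation between all their powers.  Hence \<open>c = 0\<close>.
\<close>

section \<open>Determinants as formal polynomials\<close>

lemma mpoly_eval_superset:
  assumes "finite A" "Poly_Mapping.keys q \<subseteq> A"
  shows "mpoly_eval x q = (\<Sum>\<mu>\<in>A. Poly_Mapping.lookup q \<mu> *
           (\<Prod>v\<in>Poly_Mapping.keys \<mu>. x v ^ Poly_Mapping.lookup \<mu> v))"
  unfolding mpoly_eval_def using assms
  by (intro sum.mono_neutral_left) (auto simp: in_keys_iff)

lemma mpoly_eval_sum: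
  assumes "finite I"
  shows "mpoly_eval x (\<Sum>i\<in>I. f i) = (\<Sum>i\<in>I. mpoly_eval x (f i))"
proof -
  define A where "A = (\<Union>i\<in>I. Poly_Mapping.keys (f i))"
  have A: "finite A" "\<And>i. i \<in> I \<Longrightarrow> Poly_Mapping.keys (f i) \<subseteq> A"
    using assms by (auto simp: A_def)
  have "mpoly_eval x (\<Sum>i\<in>I. f i) = (\<Sum>\<mu>\<in>A. (\<Sum>i\<in>I. Poly_Mapping.lookup (f i) \<mu>) *
           (\<Prod>v\<in>Poly_Mapping.keys \<mu>. x v ^ Poly_Mapping.lookup \<mu> v))"
    using keys_sum[of f I] A(1) by (subst mpoly_eval_superset[of A]) (auto simp: A_def lookup_sum)
  also have "\<dots> = (\<Sum>i\<in>I. \<Sum>\<mu>\<in>A. Poly_Mapping.lookup (f i) \<mu> *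
           (\<Prod>v\<in>Poly_Mapping.keys \<mu>. x v ^ Poly_Mapping.lookup \<mu> v))"
    by (subst sum.swap) (simp add: sum_distrib_right)
  also have "\<dots> = (\<Sum>i\<in>I. mpoly_eval x (f i))"
    using A by (intro sum.cong refl mpoly_eval_superset[symmetric])
  finally show ?thesis .
qed

lemma mpoly_eval_single:
  "mpoly_eval x (Poly_Mapping.single \<mu> c) =
     c * (\<Prod>v\<in>Poly_Mapping.keys \<mu>. x v ^ Poly_Mapping.lookup \<mu> v)"
  by (subst mpoly_eval_superset[of "{\<mu>}"]) (auto simp: lookup_single)

definition squarefree_monom :: "'v set \<Rightarrow> 'v \<Rightarrow>\<^sub>0 nat" where
  "squarefree_monom V = (\<Sum>v\<in>V. Poly_Mapping.single v 1)"

lemma lookup_squarefree_monom: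
  assumes "finite V"
  shows "Poly_Mapping.lookup (squarefree_monom V) v = (if v \<in> V then 1 else 0)"
  using assms by (simp add: squarefree_monom_def lookup_sum lookup_single when_def)

lemma keys_squarefree_monom:
  assumes "finite V"
  shows "Poly_Mapping.keys (squarefree_monom V) = V"
  using lookup_squarefree_monom[OF assms] by (auto simp: in_keys_iff split: if_splits)

text \<open>
  Leibniz's formula for \<open>c\<close> times the determinant of the generic \<open>d \<times> d\<close> matrix in which the columns
  outside \<open>C\<close> are filled with ones.  Matrix rows are counted from \<open>0\<close> and rays from \<open>1\<close>, so the
  entry in row \<open>i\<close> and column \<open>k\<close> is the variable \<open>(k, i + 1)\<close>.
\<close>
definition columns_det_poly :: "nat \<Rightarrow> nat set \<Rightarrow> complex \<Rightarrow> mpoly2" where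
  "columns_det_poly d C c = (\<Sum>p | p permutes {0..<d}.
     Poly_Mapping.single (squarefree_monom ((\<lambda>i. (p i, i + 1)) ` {i \<in> {0..<d}. p i \<in> C}))
       (c * signof p))"

lemma mpoly_eval_columns_det_poly:
  "mpoly_eval x (columns_det_poly d C c) =
     c * Determinant.det (Matrix.mat d d (\<lambda>(i, k). if k \<in> C then x (k, i + 1) else 1))"
proof -
  let ?A = "Matrix.mat d d (\<lambda>(i, k). if k \<in> C then x (k, i + 1) else 1)"
  have *: "mpoly_eval x (Poly_Mapping.single
        (squarefree_monom ((\<lambda>i. (p i, i + 1)) ` {i \<in> {0..<d}. p i \<in> C})) (c * signof p))
      = c * (signof p * (\<Prod>i = 0..<d. ?A $$ (i, p i)))" if p: "p permutes {0..<d}" for p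
  proof -
    let ?I = "{i \<in> {0..<d}. p i \<in> C}"
    have "(\<Prod>v\<in>(\<lambda>i. (p i, i + 1)) ` ?I. x v) = (\<Prod>i\<in>?I. x (p i, i + 1))"
      by (subst prod.reindex) (auto simp: inj_on_def)
    also have "\<dots> = (\<Prod>i = 0..<d. if p i \<in> C then x (p i, i + 1) else 1)"
      by (rule prod.mono_neutral_cong_left) auto
    also have "\<dots> = (\<Prod>i = 0..<d. ?A $$ (i, p i))"
      using permutes_in_image[OF p] by (intro prod.cong) auto
    finally show ?thesis
      by (simp add: mpoly_eval_single keys_squarefree_monom lookup_squarefree_monom)
  qed
  have "mpoly_eval x (columns_det_poly d C c) =
      (\<Sum>p | p permutes {0..<d}. c * (signof p * (\<Prod>i = 0..<d. ?A $$ (i, p i))))"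
    unfolding columns_det_poly_def
    by (subst mpoly_eval_sum[OF finite_permutations[OF finite_atLeastLessThan]])
      (intro sum.cong refl *, simp)
  then show ?thesis
    by (simp add: det_def'[of ?A d] sum_distrib_left)
qed

lemma keys_columns_det_poly:
  assumes "\<mu> \<in> Poly_Mapping.keys (columns_det_poly d C c)"
  obtains p where "p permutes {0..<d}"
    "\<mu> = squarefree_monom ((\<lambda>i. (p i, i + 1)) ` {i \<in> {0..<d}. p i \<in> C})"
proof -
  have "\<mu> \<in> (\<Union>p\<in>{p. p permutes {0..<d}}. Poly_Mapping.keys (Poly_Mapping.single
      (squarefree_monom ((\<lambda>i. (p i, i + 1)) ` {i \<in> {0..<d}. p i \<in> C})) (c * signof p)))"
    using assms unfolding columns_det_poly_def by (rule subsetD[OF keys_sum])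
  then show ?thesis
    using that by (auto split: if_splits)
qed

lemma mpoly_vars_columns_det_poly:
  "mpoly_vars (columns_det_poly d C c) \<subseteq> {0..d - 1} \<times> {1..d}"
proof -
  have "Poly_Mapping.keys \<mu> \<subseteq> {0..d - 1} \<times> {1..d}"
    if key: "\<mu> \<in> Poly_Mapping.keys (columns_det_poly d C c)" for \<mu>
  proof -
    obtain p where p: "p permutes {0..<d}"
      and \<mu>: "\<mu> = squarefree_monom ((\<lambda>i. (p i, i + 1)) ` {i \<in> {0..<d}. p i \<in> C})"
      using key by (rule keys_columns_det_poly)
    have "p i \<le> d - 1" if "i < d" for i
      using permutes_in_image[OF p, of i] that by simp
    then show ?thesis
      unfolding \<mu> by (subst keys_squarefree_monom) auto
  qed
  then show ?thesis by (auto simp: mpoly_vars_def)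
qed

text \<open>
  Every monomial has degree \<open>d - 1\<close>, so only the presence of some monomial needs an argument.  With two
  columns of ones the polynomial would be zero; with one it takes the nonzero value \<open>c\<close> at the identity
  matrix.
\<close>
lemma mpoly_total_degree_columns_det_poly:
  assumes k: "k < d" and c: "c \<noteq> 0"
  shows "mpoly_total_degree (columns_det_poly d ({0..<d} - {k}) c) = d - 1"
proof -
  define C where "C = {0..<d} - {k}"
  let ?K = "Poly_Mapping.keys (columns_det_poly d C c)"
  have deg: "(\<Sum>v\<in>Poly_Mapping.keys \<mu>. Poly_Mapping.lookup \<mu> v) = d - 1" if key: "\<mu> \<in> ?K" for \<mu>
  proof -
    obtain p where p: "p permutes {0..<d}"
      and \<mu>: "\<mu> = squarefree_monom ((\<lambda>i. (p i, i + 1)) ` {i \<in> {0..<d}. p i \<in> C})"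
      using key by (rule keys_columns_det_poly)
    let ?V = "(\<lambda>i. (p i, i + 1)) ` {i \<in> {0..<d}. p i \<in> C}"
    have "(\<Sum>v\<in>Poly_Mapping.keys \<mu>. Poly_Mapping.lookup \<mu> v) = card ?V"
      unfolding \<mu> by (subst keys_squarefree_monom) (simp_all add: lookup_squarefree_monom)
    also have "\<dots> = card {i \<in> {0..<d}. p i \<in> C}"
      by (rule card_image) (auto simp: inj_on_def)
    also have "\<dots> = card (p ` {i \<in> {0..<d}. p i \<in> C})"
      using permutes_inj[OF p] by (intro card_image[symmetric]) (auto simp: inj_on_def inj_def)
    also have "p ` {i \<in> {0..<d}. p i \<in> C} = p ` {0..<d} \<inter> C"
      by auto
    also have "\<dots> = C"
      using permutes_image[OF p] by (auto simp: C_def)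
    finally show ?thesis
      using k by (simp add: C_def)
  qed
  have "?K \<noteq> {}"
  proof
    assume "?K = {}"
    define x :: "nat \<times> nat \<Rightarrow> complex" where "x = (\<lambda>(k, l). if l = k + 1 then 1 else 0)"
    let ?A = "Matrix.mat d d (\<lambda>(i, k). if k \<in> C then x (k, i + 1) else 1)"
    let ?e = "Matrix.vec d (\<lambda>_. 1 :: complex)"
    have "?A = replace_col (1\<^sub>m d) (1\<^sub>m d *\<^sub>v ?e) k"
      by (intro eq_matI) (auto simp: replace_col_def C_def x_def)
    then have "Determinant.det ?A = vec_index ?e k * Determinant.det (1\<^sub>m d)"
      using k by (simp only: cramer_lemma_mat[OF one_carrier_mat vec_carrier])
    then have "Determinant.det ?A = 1"
      using k by simp
    then have "mpoly_eval x (columns_det_poly d C c) = c"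
      by (simp add: mpoly_eval_columns_det_poly)
    with \<open>?K = {}\<close> c show False
      by (simp add: mpoly_eval_def)
  qed
  then have "(\<lambda>\<mu>. \<Sum>v\<in>Poly_Mapping.keys \<mu>. Poly_Mapping.lookup \<mu> v) ` ?K = {d - 1}"
    by (simp add: deg image_constant_conv cong: image_cong)
  then show ?thesis
    by (simp add: mpoly_total_degree_def C_def)
qed

section \<open>Moments along the rays\<close>

lemma norm_poly_le:
  fixes p :: "'a :: real_normed_field poly"
  shows "norm (poly p z) \<le> poly (map_poly norm p) (norm z)"
proof (induction p)
  case (pCons a p)
  have "norm (poly (pCons a p) z) \<le> norm a + norm z * norm (poly p z)"
    using norm_triangle_ineq[of a "z * poly p z"] by (simp add: norm_mult)
  also have "\<dots> \<le> norm a + norm z * poly (map_poly norm p) (norm z)"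
    using pCons.IH by (intro add_left_mono mult_left_mono) auto
  finally show ?case
    using pCons.hyps by (simp add: map_poly_pCons)
qed simp

lemma norm_poly_le_exp:
  fixes p :: "'a :: real_normed_field poly"
  shows "\<exists>C n. C \<ge> 0 \<and> (\<forall>z. norm (poly p z) \<le> C * exp (real n * norm z))"
proof (induction p)
  case 0
  then show ?case by (auto intro: exI[of _ 0])
next
  case (pCons a p)
  then obtain C n where C: "C \<ge> 0" "\<And>z. norm (poly p z) \<le> C * exp (real n * norm z)"
    by blast
  have "norm (poly (pCons a p) z) \<le> (norm a + C) * exp (real (Suc n) * norm z)" for z
  proof -
    have "norm z \<le> exp (norm z)"
      using exp_ge_add_one_self[of "norm z"] by linarith
    then have "norm z * norm (poly p z) \<le> exp (norm z) * (C * exp (real n * norm z))"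
      using C(2)[of z] by (intro mult_mono) auto
    moreover have "norm a * 1 \<le> norm a * exp (real (Suc n) * norm z)"
      by (intro mult_left_mono) auto
    moreover have "norm (poly (pCons a p) z) \<le> norm a + norm z * norm (poly p z)"
      using norm_triangle_ineq[of a "z * poly p z"] by (simp add: norm_mult)
    ultimately show ?thesis
      by (simp add: algebra_simps exp_add)
  qed
  then show ?case
    using C(1) by (intro exI[of _ "norm a + C"] exI[of _ "Suc n"]) auto
qed

lemma eventually_poly_minus_power_le:
  fixes R :: "real poly"
  assumes d: "d \<ge> 2" and R: "degree R < d"
  shows "eventually (\<lambda>t. poly R t - t ^ d / real d \<le> - t) at_top"
proof -
  let ?q = "Polynomial.monom (1 / real d) d - R - [:0, 1:]"
  have "coeff R d = 0" "coeff [:0, 1 :: real:] d = 0"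
    using d R by (intro coeff_eq_0; simp)+
  then have cq: "coeff ?q d = 1 / real d"
    by simp
  moreover have "degree ?q = d"
  proof (rule antisym)
    show "degree ?q \<le> d"
      using d R by (intro degree_diff_le degree_monom_le) auto
    show "d \<le> degree ?q"
      by (rule le_degree, subst cq) (use d in simp)
  qed
  ultimately have lc: "lead_coeff ?q = 1 / real d" by metis
  then obtain n where n: "\<And>t. t \<ge> n \<Longrightarrow> poly ?q t \<ge> 1 / real d"
    using poly_pinfty_gt_lc[of ?q] d by auto
  have "poly R t - t ^ d / real d \<le> - t" if "t \<ge> n" for t
  proof -
    have "0 \<le> poly ?q t"
      using n[OF that] by (rule order_trans[rotated]) simp
    then show ?thesis by (simp add: poly_monom)
  qed
  then show ?thesis
    by (auto simp: eventually_at_top_linorder)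
qed

lemma set_integrable_exp_poly:
  fixes R :: "real poly"
  assumes d: "d \<ge> 2" and R: "degree R < d"
  shows "set_integrable lborel {0..} (\<lambda>t. exp (poly R t - t ^ d / real d))"
proof -
  let ?f = "\<lambda>t. exp (poly R t - t ^ d / real d)"
  obtain K0 where K0: "\<And>t. t \<ge> K0 \<Longrightarrow> poly R t - t ^ d / real d \<le> - t"
    using eventually_poly_minus_power_le[OF assms] by (auto simp: eventually_at_top_linorder)
  define K where "K = max 0 K0"
  have "(\<lambda>t::real. exp (- t)) absolutely_integrable_on {K..}"
    using integrable_on_exp_minus_to_infinity[of 1 K]
    by (intro nonnegative_absolutely_integrable_1) auto
  then have e: "set_integrable lborel {K..} (\<lambda>t::real. exp (- t))"
    unfolding set_integrable_def by (subst (asm) integrable_completion) auto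
  have "set_integrable lborel {K..} ?f"
    by (rule set_integrable_bound[OF e])
      (use K0 d in \<open>auto simp: K_def set_borel_measurable_def simp del: real_scaleR_def
        intro!: borel_measurable_continuous_on_indicator continuous_intros\<close>)
  moreover have "set_integrable lborel {0..K} ?f"
    by (intro borel_integrable_atLeastAtMost' continuous_intros) (use d in auto)
  ultimately have "set_integrable lborel ({0..K} \<union> {K..}) ?f"
    by (intro set_integrable_Un) auto
  moreover have "{0..K} \<union> {K..} = {0..}"
    by (auto simp: K_def)
  ultimately show ?thesis by simp
qed

lemma tendsto_exp_poly_0:
  fixes R :: "real poly"
  assumes d: "d \<ge> 2" and R: "degree R < d"
  shows "((\<lambda>t. exp (poly R t - t ^ d / real d)) \<longlongrightarrow> 0) at_top"
proof (rule Lim_null_comparison)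
  show "eventually (\<lambda>t. norm (exp (poly R t - t ^ d / real d)) \<le> exp (- t)) at_top"
    using eventually_poly_minus_power_le[OF assms] by eventually_elim simp
  show "((\<lambda>t::real. exp (- t)) \<longlongrightarrow> 0) at_top"
    by (rule filterlim_compose[OF exp_at_bot filterlim_uminus_at_bot_at_top])
qed

lemma norm_root_of_unity:
  fixes w :: complex
  assumes "w ^ d = 1" "d \<ge> 2"
  shows "norm w = 1"
  using assms by (metis norm_one norm_power power_eq_1_iff norm_ge_zero not_numeral_le_zero)

lemma normalized_poly_monom:
  assumes "d \<ge> 2"
  shows "normalized_poly d (Polynomial.monom (- 1 / of_nat d) d)"
  using assms by (simp add: normalized_poly_def degree_monom_eq)

lemma degree_diff_normalized_poly:
  assumes "d \<ge> 2" "normalized_poly d P" "normalized_poly d P'"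
  shows "degree (P - P') < d"
proof (rule degree_lessI)
  show "\<forall>k\<ge>d. coeff (P - P') k = 0"
  proof (intro allI impI)
    fix k assume "k \<ge> d"
    then show "coeff (P - P') k = 0"
      using assms(2,3) by (cases "k = d") (auto simp: normalized_poly_def coeff_eq_0)
  qed
qed (use assms(1) in auto)

text \<open>
  On the rays, the real part of \<open>P\<close> is \<open>- t ^ d / d\<close> plus terms of lower order, and the
  factor \<open>Q\<close> is absorbed into a linear term, which also has lower order as \<open>d \<ge> 2\<close>.  Hence a
  majorant of the form \<open>C * exp (R t - t ^ d / d)\<close> controls integrability, the boundary
  term at infinity, and the interchange of sum and integral.
\<close>
lemma normalized_poly_ray_bound:
  fixes P Q :: "complex poly"
  assumes d: "d \<ge> 2" and P: "normalized_poly d P"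
  obtains C R where "C \<ge> 0" "degree R < d"
    "\<And>w t. w ^ d = 1 \<Longrightarrow> t \<ge> 0 \<Longrightarrow>
       norm (poly Q (of_real t * w) * exp (poly P (of_real t * w))) \<le> C * exp (poly R t - t ^ d / real d)"
proof -
  define S where "S = P - Polynomial.monom (- 1 / of_nat d) d"
  have "degree S < d"
    unfolding S_def using d P by (intro degree_diff_normalized_poly normalized_poly_monom)
  obtain C n where C: "C \<ge> 0" "\<And>z. norm (poly Q z) \<le> C * exp (real n * norm z)"
    using norm_poly_le_exp[of Q] by blast
  define R where "R = map_poly norm S + [:0, real n:]"
  have "degree R < d"
    unfolding R_def
  proof (rule degree_add_less)
    show "degree (map_poly norm S) < d"
      using degree_map_poly[of norm S] \<open>degree S < d\<close> by simp
  qed (use d in auto)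
  moreover have "norm (poly Q (of_real t * w) * exp (poly P (of_real t * w)))
      \<le> C * exp (poly R t - t ^ d / real d)" if w: "w ^ d = 1" and t: "t \<ge> 0" for w t
  proof -
    have [simp]: "norm w = 1"
      using w d by (rule norm_root_of_unity)
    let ?z = "of_real t * w"
    have "poly P ?z = poly S ?z - complex_of_real (t ^ d / real d)"
      using w by (simp add: S_def poly_monom power_mult_distrib)
    then have "Re (poly P ?z) = Re (poly S ?z) - t ^ d / real d"
      by simp
    also have "\<dots> \<le> poly (map_poly norm S) t - t ^ d / real d"
      using complex_Re_le_cmod[of "poly S ?z"] norm_poly_le[of S ?z] t by (simp add: norm_mult)
    finally have "exp (Re (poly P ?z)) \<le> exp (poly (map_poly norm S) t - t ^ d / real d)"
      by simp
    then have "norm (poly Q ?z) * exp (Re (poly P ?z))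
        \<le> (C * exp (real n * t)) * exp (poly (map_poly norm S) t - t ^ d / real d)"
      using C(2)[of ?z] t C(1) by (intro mult_mono) (auto simp: norm_mult)
    also have "\<dots> = C * exp (poly R t - t ^ d / real d)"
      by (simp add: R_def exp_add exp_diff algebra_simps)
    finally show ?thesis
      by (simp add: norm_mult)
  qed
  ultimately show ?thesis
    using that C(1) by blast
qed

definition ray_moment :: "complex poly \<Rightarrow> complex \<Rightarrow> complex poly \<Rightarrow> complex" where
  "ray_moment P w Q = ray_integral w (\<lambda>z. poly Q z * exp (poly P z))"

lemma ray_moment_integrable:
  assumes d: "d \<ge> 2" and P: "normalized_poly d P" and w: "w ^ d = 1"
  shows "set_integrable lborel {0..}
           (\<lambda>t. poly Q (of_real t * w) * exp (poly P (of_real t * w)) * w)"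
proof -
  obtain C R where CR: "C \<ge> 0" "degree R < d"
    "\<And>w t. w ^ d = 1 \<Longrightarrow> t \<ge> 0 \<Longrightarrow>
       norm (poly Q (of_real t * w) * exp (poly P (of_real t * w))) \<le> C * exp (poly R t - t ^ d / real d)"
    using normalized_poly_ray_bound[OF d P, of Q] by blast
  have "set_integrable lborel {0..} (\<lambda>t. C * exp (poly R t - t ^ d / real d))"
    using set_integrable_exp_poly[OF d CR(2)] by (intro set_integrable_mult_right)
  then have "set_integrable lborel {0..}
           (\<lambda>t. poly Q (of_real t * w) * exp (poly P (of_real t * w)))"
    by (rule set_integrable_bound)
      (use CR(3)[OF w] CR(1) in \<open>auto simp: set_borel_measurable_def
        intro!: borel_measurable_continuous_on_indicator continuous_intros\<close>)
  then show ?thesis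
    by (intro set_integrable_mult_left)
qed

lemma ray_moment_add:
  assumes "d \<ge> 2" "normalized_poly d P" "w ^ d = 1"
  shows "ray_moment P w (Q1 + Q2) = ray_moment P w Q1 + ray_moment P w Q2"
  unfolding ray_moment_def ray_integral_def
  using set_integral_add(2)[OF ray_moment_integrable[OF assms, of Q1] ray_moment_integrable[OF assms, of Q2]]
  by (simp add: algebra_simps)

lemma ray_moment_smult: "ray_moment P w (Polynomial.smult c Q) = c * ray_moment P w Q"
  unfolding ray_moment_def ray_integral_def by (simp add: mult.assoc)

lemma ray_moment_sum:
  assumes "d \<ge> 2" "normalized_poly d P" "w ^ d = 1"
  shows "ray_moment P w (\<Sum>i\<in>I. f i) = (\<Sum>i\<in>I. ray_moment P w (f i))"
proof (induction I rule: infinite_finite_induct)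
  case (insert i I)
  then show ?case by (simp add: ray_moment_add[OF assms])
qed (simp_all add: ray_moment_def ray_integral_def)

text \<open>
  The integrand is the derivative of \<open>Q e\<^sup>P\<close> along the ray, which tends to \<open>0\<close> at infinity.  The
  choice \<open>Q = 1\<close> yields the linear system for the coefficients of \<open>P\<close>, and choices with
  \<open>Q(0) = 0\<close> yield recursions between moments.
\<close>
lemma ray_moment_by_parts:
  assumes d: "d \<ge> 2" and P: "normalized_poly d P" and w: "w ^ d = 1"
  shows "ray_moment P w (pderiv Q + Q * pderiv P) = - (poly Q 0 * exp (poly P 0))"
proof -
  let ?F = "\<lambda>t. poly Q (of_real t * w) * exp (poly P (of_real t * w))"
  let ?f = "\<lambda>t. poly (pderiv Q + Q * pderiv P) (of_real t * w) * exp (poly P (of_real t * w)) * w"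
  have deriv: "(?F has_vector_derivative ?f t) (at t within A)" for t A
  proof -
    have "((\<lambda>z. poly Q (z * w) * exp (poly P (z * w))) has_field_derivative ?f t) (at (of_real t))"
      by (auto intro!: derivative_eq_intros simp: algebra_simps)
    from has_vector_derivative_real_field[OF this] show ?thesis .
  qed
  have "((\<lambda>b. LBINT t:{0..b}. ?f t) \<longlongrightarrow> (LBINT t:{0..}. ?f t)) at_top"
    by (intro tendsto_set_lebesgue_integral_at_top ray_moment_integrable[OF d P w]) simp
  moreover have "eventually (\<lambda>b. (LBINT t:{0..b}. ?f t) = ?F b - ?F 0) at_top"
    using eventually_ge_at_top[of 0]
  proof eventually_elim
    case (elim b)
    show ?case
      unfolding set_lebesgue_integral_def using elim deriv
      by (intro integral_FTC_atLeastAtMost continuous_intros) auto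
  qed
  ultimately have "((\<lambda>b. ?F b - ?F 0) \<longlongrightarrow> (LBINT t:{0..}. ?f t)) at_top"
    by (rule Lim_transform_eventually)
  moreover have "(?F \<longlongrightarrow> 0) at_top"
  proof -
    obtain C R where CR: "C \<ge> 0" "degree R < d"
      "\<And>w t. w ^ d = 1 \<Longrightarrow> t \<ge> 0 \<Longrightarrow>
         norm (poly Q (of_real t * w) * exp (poly P (of_real t * w))) \<le> C * exp (poly R t - t ^ d / real d)"
      using normalized_poly_ray_bound[OF d P, of Q] by blast
    have lim: "((\<lambda>t. C * exp (poly R t - t ^ d / real d)) \<longlongrightarrow> 0) at_top"
      using tendsto_mult[OF tendsto_const tendsto_exp_poly_0[OF d CR(2)], of C] by simp
    show ?thesis
      by (rule Lim_null_comparison[OF _ lim])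
        (use CR(3)[OF w] in \<open>auto intro: eventually_mono[OF eventually_ge_at_top[of 0]]\<close>)
  qed
  then have "((\<lambda>b. ?F b - ?F 0) \<longlongrightarrow> 0 - ?F 0) at_top"
    by (intro tendsto_intros)
  ultimately have "(LBINT t:{0..}. ?f t) = 0 - ?F 0"
    by (rule tendsto_unique[OF trivial_limit_at_top_linorder])
  then show ?thesis
    by (simp add: ray_moment_def ray_integral_def)
qed

lemma norm_exp_partial_sum_le:
  fixes s :: complex
  shows "norm (\<Sum>i<n. s ^ i / fact i) \<le> exp (norm s)"
proof -
  have "norm (\<Sum>i<n. s ^ i / fact i) \<le> (\<Sum>i<n. norm s ^ i / fact i)"
    by (rule order_trans[OF norm_sum]) (simp add: norm_divide norm_power)
  also have "\<dots> \<le> suminf (\<lambda>i. norm s ^ i / fact i)"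
    using summable_exp_generic[of "norm s"] by (intro sum_le_suminf) (auto simp: divide_inverse mult.commute)
  also have "\<dots> = exp (norm s)"
    by (simp add: exp_def divide_inverse mult.commute)
  finally show ?thesis .
qed

text \<open>
  Since \<open>S\<close> has degree below \<open>d\<close>, even \<open>e\<^bsup>|S|\<^esup> |Q e\<^sup>P|\<close> has a
  majorant of the integrable form, so the exponential series of \<open>S\<close> may be integrated term by term.
  This compares the moments of two normalized polynomials by means of moments of the first alone.
\<close>
lemma ray_moment_sums:
  assumes d: "d \<ge> 2" and P: "normalized_poly d P" and w: "w ^ d = 1"
    and S: "degree S < d"
  shows "(\<lambda>n. ray_moment P w (Q * S ^ n) / fact n) sums ray_moment (P + S) w Q"
proof -
  obtain C R where CR: "C \<ge> 0" "degree R < d"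
    "\<And>w t. w ^ d = 1 \<Longrightarrow> t \<ge> 0 \<Longrightarrow>
       norm (poly Q (of_real t * w) * exp (poly P (of_real t * w))) \<le> C * exp (poly R t - t ^ d / real d)"
    using normalized_poly_ray_bound[OF d P, of Q] by blast
  have [simp]: "norm w = 1"
    using w d by (rule norm_root_of_unity)
  define R' where "R' = R + map_poly norm S"
  have R': "degree R' < d"
    unfolding R'_def using CR(2) S degree_map_poly[of norm S] by (intro degree_add_less) auto
  let ?g = "\<lambda>t. poly Q (of_real t * w) * exp (poly P (of_real t * w)) * w"
  let ?T = "\<lambda>n t. \<Sum>i<n. poly S (of_real t * w) ^ i / fact i"
  have "(\<lambda>n. LBINT t:{0..}. ?T n t * ?g t) \<longlonglongrightarrow> (LBINT t:{0..}. exp (poly S (of_real t * w)) * ?g t)"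
    unfolding set_lebesgue_integral_def
  proof (rule integral_dominated_convergence)
    show "integrable lborel (\<lambda>t. indicator {0..} t *\<^sub>R (C * exp (poly R' t - t ^ d / real d)))"
      using set_integrable_mult_right[OF set_integrable_exp_poly[OF d R'], of C]
      by (simp add: set_integrable_def)
    show "AE t in lborel. norm (indicator {0..} t *\<^sub>R (?T n t * ?g t))
        \<le> indicator {0..} t *\<^sub>R (C * exp (poly R' t - t ^ d / real d))" for n
    proof (intro AE_I2)
      fix t :: real
      show "norm (indicator {0..} t *\<^sub>R (?T n t * ?g t))
        \<le> indicator {0..} t *\<^sub>R (C * exp (poly R' t - t ^ d / real d))"
      proof (cases "t \<ge> 0")
        case True
        have "norm (?T n t) \<le> exp (norm (poly S (of_real t * w)))"
          by (rule norm_exp_partial_sum_le)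
        also have "\<dots> \<le> exp (poly (map_poly norm S) t)"
          using norm_poly_le[of S "of_real t * w"] True by (simp add: norm_mult)
        finally have "norm (?T n t) * norm (?g t) \<le>
            exp (poly (map_poly norm S) t) * (C * exp (poly R t - t ^ d / real d))"
          using CR(3)[OF w True] by (intro mult_mono) (auto simp: norm_mult)
        also have "\<dots> = C * exp (poly R' t - t ^ d / real d)"
          by (simp add: R'_def exp_add exp_diff)
        finally show ?thesis
          using True by (simp add: norm_mult)
      qed simp
    qed
    show "AE t in lborel. (\<lambda>n. indicator {0..} t *\<^sub>R (?T n t * ?g t)) \<longlonglongrightarrow>
        indicator {0..} t *\<^sub>R (exp (poly S (of_real t * w)) * ?g t)"
    proof (intro AE_I2 tendsto_intros)
      fix t :: real
      show "(\<lambda>n. ?T n t) \<longlonglongrightarrow> exp (poly S (of_real t * w))"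
        using exp_converges[of "poly S (of_real t * w)"]
        by (simp add: sums_def scaleR_conv_of_real divide_inverse mult.commute)
    qed
  qed (auto intro!: borel_measurable_continuous_on_indicator continuous_intros)
  moreover have "(LBINT t:{0..}. ?T n t * ?g t) = (\<Sum>i<n. ray_moment P w (Q * S ^ i) / fact i)" for n
  proof -
    have "(\<Sum>i<n. ray_moment P w (Q * S ^ i) / fact i) =
        ray_moment P w (\<Sum>i<n. Polynomial.smult (1 / fact i) (Q * S ^ i))"
      by (simp add: ray_moment_sum[OF d P w] ray_moment_smult)
    also have "\<dots> = (LBINT t:{0..}. ?T n t * ?g t)"
      unfolding ray_moment_def ray_integral_def
      by (simp add: poly_sum sum_distrib_left sum_distrib_right algebra_simps)
    finally show ?thesis ..
  qed
  moreover have "(LBINT t:{0..}. exp (poly S (of_real t * w)) * ?g t) = ray_moment (P + S) w Q"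
    unfolding ray_moment_def ray_integral_def by (simp add: exp_add algebra_simps)
  ultimately show ?thesis
    by (simp add: sums_def)
qed

text \<open>
  By induction on the degree \<open>n \<ge> d\<close> of \<open>Q\<close>: adding \<open>A' + A P'\<close> with
  \<open>A\<close> a suitable multiple of \<open>z ^ (n - d + 1)\<close> cancels the leading term, and the moments
  of \<open>A' + A P'\<close> vanish by integration by parts because \<open>A(0) = 0\<close>.
\<close>
lemma ray_moments_annihilate_all:
  fixes L :: "'i set" and c w :: "'i \<Rightarrow> complex"
  assumes d: "d \<ge> 2" and P: "normalized_poly d P" and w: "\<And>l. l \<in> L \<Longrightarrow> w l ^ d = 1"
    and rel: "\<And>k. k < d \<Longrightarrow> (\<Sum>l\<in>L. c l * ray_moment P (w l) (Polynomial.monom 1 k)) = 0"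
  shows "(\<Sum>l\<in>L. c l * ray_moment P (w l) Q) = 0"
proof -
  define \<Lambda> where "\<Lambda> Q = (\<Sum>l\<in>L. c l * ray_moment P (w l) Q)" for Q
  have add: "\<Lambda> (Q1 + Q2) = \<Lambda> Q1 + \<Lambda> Q2" for Q1 Q2
    using w by (simp add: \<Lambda>_def ray_moment_add[OF d P] algebra_simps sum.distrib)
  have low: "\<Lambda> Q = 0" if "degree Q < d" for Q
  proof -
    have "\<Lambda> Q = \<Lambda> (\<Sum>k\<le>degree Q. Polynomial.smult (coeff Q k) (Polynomial.monom 1 k))"
      by (simp add: smult_monom poly_as_sum_of_monoms)
    also have "\<dots> = (\<Sum>l\<in>L. \<Sum>k\<le>degree Q. coeff Q k * (c l * ray_moment P (w l) (Polynomial.monom 1 k)))"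
      using w by (simp add: \<Lambda>_def ray_moment_sum[OF d P] ray_moment_smult sum_distrib_left mult_ac
          del: smult_monom)
    also have "\<dots> = (\<Sum>k\<le>degree Q. coeff Q k * (\<Sum>l\<in>L. c l * ray_moment P (w l) (Polynomial.monom 1 k)))"
      by (subst sum.swap) (simp add: sum_distrib_left)
    also have "\<dots> = 0"
      using rel that by (intro sum.neutral) auto
    finally show ?thesis .
  qed
  have "\<Lambda> Q = 0"
  proof (induction "degree Q" arbitrary: Q rule: less_induct)
    case less
    show ?case
    proof (cases "degree Q < d")
      case False
      define n where "n = degree Q"
      define A where "A = Polynomial.monom (lead_coeff Q) (n - d + 1)"
      define U where "U = pderiv A + A * pderiv P"
      have n: "n \<ge> d" using False by (simp add: n_def)
      have degP: "degree P = d" "coeff P d = - 1 / of_nat d"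
        using P by (auto simp: normalized_poly_def)
      have degA': "degree (pderiv A) \<le> n - d"
        by (simp add: A_def pderiv_monom degree_monom_le)
      have degAP: "degree (A * pderiv P) \<le> n"
      proof -
        have "degree (A * pderiv P) \<le> degree A + degree (pderiv P)"
          by (rule degree_mult_le)
        also have "\<dots> \<le> (n - d + 1) + (d - 1)"
          using degP by (intro add_mono) (simp_all add: A_def degree_monom_le degree_pderiv)
        finally show ?thesis using n d by simp
      qed
      (* The leading coefficient - 1 / d of P makes that of P' equal to - 1. *)
      have "coeff (A * pderiv P) n = lead_coeff Q * coeff (pderiv P) (d - 1)"
        using n d by (simp add: A_def coeff_monom_mult)
      also have "coeff (pderiv P) (d - 1) = - 1"
        using d degP(2) by (simp add: coeff_pderiv)
      finally have "coeff U n = - lead_coeff Q"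
        using degA' n d by (simp add: U_def coeff_eq_0)
      then have "coeff (Q + U) k = 0" if "k \<ge> n" for k
        using that degA' degAP d n
        by (cases "k = n") (auto simp: U_def n_def coeff_eq_0)
      then have "degree (Q + U) < n"
        using n d by (intro degree_lessI) auto
      then have "\<Lambda> (Q + U) = 0"
        by (rule less.hyps[unfolded n_def[symmetric]])
      moreover have "\<Lambda> U = 0"
      proof -
        have "poly A 0 = 0" by (simp add: A_def poly_monom)
        then show ?thesis
          using w by (simp add: \<Lambda>_def U_def ray_moment_by_parts[OF d P])
      qed
      ultimately show ?thesis by (simp add: add)
    qed (rule low)
  qed
  then show ?thesis by (simp add: \<Lambda>_def)
qed

lemma exp_power_moment_nonzero:
  assumes d: "d \<ge> 2"
  shows "(LBINT t:{0..}. t ^ k * exp (- (t ^ d / real d))) \<noteq> (0 :: real)"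
proof
  let ?P = "Polynomial.monom (- 1 / of_nat d) d :: complex poly"
  let ?f = "\<lambda>t::real. t ^ k * exp (- (t ^ d / real d))"
  assume 0: "(LBINT t:{0..}. ?f t) = 0"
  have "normalized_poly d ?P"
    using d by (rule normalized_poly_monom)
  then have "set_integrable lborel {0..}
      (\<lambda>t. poly (Polynomial.monom 1 k) (of_real t * 1) * exp (poly ?P (of_real t * 1)) * 1)"
    by (intro ray_moment_integrable[OF d]) auto
  also have "(\<lambda>t. poly (Polynomial.monom 1 k) (of_real t * 1) * exp (poly ?P (of_real t * 1)) * 1)
      = (\<lambda>t. complex_of_real (?f t))"
    by (simp add: poly_monom flip: exp_of_real)
  finally have "set_integrable lborel {0..} (\<lambda>t. complex_of_real (?f t))" .
  from integrable_norm[OF this[unfolded set_integrable_def]]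
  have int: "integrable lborel (\<lambda>t. indicator {0..} t *\<^sub>R ?f t)"
    by (rule Bochner_Integration.integrable_cong[THEN iffD1, rotated -1])
      (auto simp: norm_mult norm_power indicator_def)
  have "AE t in lborel. indicator {0..} t *\<^sub>R ?f t = 0"
    using 0 by (subst integral_nonneg_eq_0_iff_AE[OF int, symmetric])
      (auto simp: set_lebesgue_integral_def indicator_def)
  then have "AE t in lborel. t \<notin> {0<..<1::real}"
    by eventually_elim (auto simp: indicator_def)
  then have "emeasure lborel {0<..<1::real} = 0"
    by (subst (asm) AE_iff_measurable[of "{0<..<1}"]) auto
  then show False by simp
qed

lemma ray_moment_monom_monom:
  assumes w: "w ^ d = 1"
  shows "ray_moment (Polynomial.monom (- 1 / of_nat d) d) w (Polynomial.monom 1 k) =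
    w ^ (k + 1) * of_real (LBINT t:{0..}. t ^ k * exp (- (t ^ d / real d)))"
proof -
  have "poly (Polynomial.monom 1 k) (of_real t * w) *
      exp (poly (Polynomial.monom (- 1 / of_nat d) d) (of_real t * w)) * w
      = w ^ (k + 1) * complex_of_real (t ^ k * exp (- (t ^ d / real d)))" for t
    using w by (simp add: poly_monom power_mult_distrib flip: exp_of_real)
  then have "ray_moment (Polynomial.monom (- 1 / of_nat d) d) w (Polynomial.monom 1 k) =
    (LBINT t:{0..}. w ^ (k + 1) * complex_of_real (t ^ k * exp (- (t ^ d / real d))))"
    unfolding ray_moment_def ray_integral_def by (simp only:)
  then show ?thesis
    by (simp only: set_integral_mult_right set_integral_complex_of_real)
qed

text \<open>
  The relation extends from powers to \<open>w l * q (w l)\<close> for every polynomial \<open>q\<close>; the Lagrange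
  polynomial that vanishes at all nodes but \<open>w i\<close> isolates \<open>c i\<close>.
\<close>
lemma power_sums_zero_imp_coeffs_zero:
  fixes w c :: "'i \<Rightarrow> complex"
  assumes L: "finite L" and inj: "inj_on w L" and nz: "\<And>l. l \<in> L \<Longrightarrow> w l \<noteq> 0"
    and rel: "\<And>k. (\<Sum>l\<in>L. c l * w l ^ (k + 1)) = 0" and i: "i \<in> L"
  shows "c i = 0"
proof -
  define q where "q = (\<Prod>l\<in>L - {i}. [:- w l, 1:])"
  have q: "poly q (w l) = 0" if "l \<in> L" "l \<noteq> i" for l
    using that L by (auto simp: q_def poly_prod)
  have qi: "poly q (w i) \<noteq> 0"
    using L i inj by (auto simp: q_def poly_prod inj_on_def)
  have "0 = (\<Sum>k\<le>degree q. coeff q k * (\<Sum>l\<in>L. c l * w l ^ (k + 1)))"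
    using rel by simp
  also have "\<dots> = (\<Sum>l\<in>L. \<Sum>k\<le>degree q. coeff q k * (c l * w l ^ (k + 1)))"
    by (subst sum.swap) (simp add: sum_distrib_left)
  also have "\<dots> = (\<Sum>l\<in>L. c l * w l * poly q (w l))"
    by (simp add: poly_altdef sum_distrib_left mult_ac)
  also have "\<dots> = (\<Sum>l\<in>L. if l = i then c i * w i * poly q (w i) else 0)"
    using q by (intro sum.cong) auto
  also have "\<dots> = c i * w i * poly q (w i)"
    using L i by simp
  finally show ?thesis
    using qi nz[OF i] by simp
qed

section \<open>The ramificant\<close>

lemma ram_moment_eq: "ram_moment \<omega> P (k, l) = ray_moment P (\<omega> l) (Polynomial.monom 1 k)"
  by (simp add: ram_moment_def ray_moment_def poly_monom)

text \<open>
  A vector \<open>v\<close> in the kernel of the transposed matrix is a relation between the rows.  It is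
  extended from the monomials of degree below \<open>d\<close> to all polynomials, then moved from \<open>P\<close> to the
  model \<open>- z ^ d / d\<close>, where the moments are explicit and force \<open>v = 0\<close>.
\<close>
lemma ramificant_nonzero:
  assumes d: "d \<ge> 2" and \<omega>: "enumerates_roots_of_unity d \<omega>" and P: "normalized_poly d P"
  shows "ramificant d \<omega> P \<noteq> 0"
proof
  assume 0: "ramificant d \<omega> P = 0"
  let ?M = "Matrix.mat d d (\<lambda>(i, k). ram_moment \<omega> P (k, i + 1))"
  let ?w = "\<lambda>i. \<omega> (i + 1)"
  have w: "?w i ^ d = 1" if "i \<in> {0..<d}" for i
    using \<omega> that by (auto simp: enumerates_roots_of_unity_def bij_betw_def)
  have "Determinant.det (transpose_mat ?M) = 0"
    using 0 by (simp add: ramificant_def det_transpose[of _ d])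
  then obtain v where v: "v \<in> carrier_vec d" "v \<noteq> 0\<^sub>v d" "transpose_mat ?M *\<^sub>v v = 0\<^sub>v d"
    using det_0_iff_vec_prod_zero[of "transpose_mat ?M" d] by auto
  let ?c = "\<lambda>i. vec_index v i"
  have "(\<Sum>i\<in>{0..<d}. ?c i * ray_moment P (?w i) (Polynomial.monom 1 k)) = 0" if k: "k < d" for k
  proof -
    have "vec_index (transpose_mat ?M *\<^sub>v v) k = (\<Sum>i\<in>{0..<d}. ram_moment \<omega> P (k, i + 1) * ?c i)"
      using k v(1) by (auto simp: scalar_prod_def intro!: sum.cong)
    moreover have "vec_index (transpose_mat ?M *\<^sub>v v) k = 0"
      unfolding v(3) using k by simp
    ultimately show ?thesis
      by (simp only: ram_moment_eq mult.commute)
  qed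
  then have ann: "(\<Sum>i\<in>{0..<d}. ?c i * ray_moment P (?w i) Q) = 0" for Q
    using ray_moments_annihilate_all[OF d P, of "{0..<d}" ?w ?c] w by blast
  define P0 :: "complex poly" where "P0 = Polynomial.monom (- 1 / of_nat d) d"
  define S where "S = P0 - P"
  have S: "degree S < d"
    unfolding S_def P0_def using d P by (intro degree_diff_normalized_poly normalized_poly_monom)
  have ann0: "(\<Sum>i\<in>{0..<d}. ?c i * ray_moment P0 (?w i) Q) = 0" for Q
  proof -
    have "(\<lambda>n. \<Sum>i\<in>{0..<d}. ?c i * (ray_moment P (?w i) (Q * S ^ n) / fact n)) sums
        (\<Sum>i\<in>{0..<d}. ?c i * ray_moment (P + S) (?w i) Q)"
      by (intro sums_sum sums_mult ray_moment_sums[OF d P _ S] w)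
    moreover have "(\<Sum>i\<in>{0..<d}. ?c i * (ray_moment P (?w i) (Q * S ^ n) / fact n)) = 0" for n
      using ann[of "Q * S ^ n"] by (simp flip: sum_divide_distrib)
    ultimately show ?thesis
      by (simp add: S_def sums_iff)
  qed
  have "?c i = 0" if "i \<in> {0..<d}" for i
  proof (rule power_sums_zero_imp_coeffs_zero[of "{0..<d}" ?w ?c, OF _ _ _ _ that])
    have "inj_on \<omega> {1..d}"
      using \<omega> by (simp add: enumerates_roots_of_unity_def bij_betw_def)
    then show "inj_on ?w {0..<d}"
      by (auto intro!: inj_onI dest: inj_onD)
    show "?w l \<noteq> 0" if "l \<in> {0..<d}" for l
    proof
      assume "?w l = 0"
      then show False
        using w[OF that] d by (simp add: power_0_left)
    qed
    show "(\<Sum>l\<in>{0..<d}. ?c l * ?w l ^ (k + 1)) = 0" for k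
    proof -
      define g where "g = (LBINT t:{0..}. t ^ k * exp (- (t ^ d / real d)))"
      have "(\<Sum>l\<in>{0..<d}. ?c l * (?w l ^ (k + 1) * of_real g)) =
          (\<Sum>l\<in>{0..<d}. ?c l * ray_moment P0 (?w l) (Polynomial.monom 1 k))"
        by (intro sum.cong refl) (simp only: P0_def g_def ray_moment_monom_monom[OF w])
      then have "(\<Sum>l\<in>{0..<d}. ?c l * ?w l ^ (k + 1)) * of_real g = 0"
        unfolding ann0 by (simp only: sum_distrib_right mult.assoc)
      then show ?thesis
        using exp_power_moment_nonzero[OF d, of k] by (simp add: g_def)
    qed
  qed simp
  then have "v = 0\<^sub>v d"
    using v(1) by (intro eq_vecI) auto
  with v(2) show False ..
qed

text \<open>
  Cramer's rule for the system obtained by integrating \<open>P' e\<^sup>P\<close> along the rays.  The factor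
  \<open>1 / j\<close> comes from \<open>coeff (pderiv P) (j - 1) = j * coeff P j\<close>, and the sign from
  \<open>\<integral> P' e\<^sup>P dz = - exp (a 0)\<close>.
\<close>
lemma ramificant_mult_coeff:
  assumes d: "d \<ge> 2" and j: "1 \<le> j" "j \<le> d - 1"
    and \<omega>: "enumerates_roots_of_unity d \<omega>" and P: "normalized_poly d P"
  shows "ramificant d \<omega> P * exp (- coeff P 0) * coeff P j =
    mpoly_eval (ram_moment \<omega> P) (columns_det_poly d ({0..<d} - {j - 1}) (- 1 / of_nat j))"
proof -
  let ?M = "Matrix.mat d d (\<lambda>(i, k). ram_moment \<omega> P (k, i + 1))"
  let ?N = "Matrix.mat d d (\<lambda>(i, k). if k \<in> {0..<d} - {j - 1} then ram_moment \<omega> P (k, i + 1) else 1)"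
  define x where "x = Matrix.vec d (\<lambda>k. - exp (- coeff P 0) * coeff (pderiv P) k)"
  have deg: "degree (pderiv P) = d - 1"
    using P by (simp add: degree_pderiv normalized_poly_def)
  have "?M *\<^sub>v x = Matrix.vec d (\<lambda>_. 1)"
  proof (rule eq_vecI)
    fix i assume i: "i < dim_vec (Matrix.vec d (\<lambda>_. 1 :: complex))"
    then have w: "\<omega> (i + 1) ^ d = 1"
      using \<omega> by (auto simp: enumerates_roots_of_unity_def bij_betw_def)
    have "pderiv P = (\<Sum>k\<le>d - 1. Polynomial.smult (coeff (pderiv P) k) (Polynomial.monom 1 k))"
      using poly_as_sum_of_monoms[of "pderiv P"] by (simp add: deg smult_monom)
    also have "{..d - 1} = {0..<d}" using d by auto
    finally have pd: "(\<Sum>k\<in>{0..<d}. Polynomial.smult (coeff (pderiv P) k) (Polynomial.monom 1 k)) = pderiv P"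
      by (rule sym)
    have "(\<Sum>k\<in>{0..<d}. coeff (pderiv P) k * ram_moment \<omega> P (k, i + 1)) =
        ray_moment P (\<omega> (i + 1))
          (\<Sum>k\<in>{0..<d}. Polynomial.smult (coeff (pderiv P) k) (Polynomial.monom 1 k))"
      by (simp only: ray_moment_sum[OF d P w] ray_moment_smult ram_moment_eq)
    also have "\<dots> = - exp (coeff P 0)"
      unfolding pd using ray_moment_by_parts[OF d P w, of 1] by (simp add: poly_0_coeff_0)
    finally have "(\<Sum>k\<in>{0..<d}. coeff (pderiv P) k * ram_moment \<omega> P (k, i + 1)) = - exp (coeff P 0)" .
    moreover have "vec_index (?M *\<^sub>v x) i =
        - exp (- coeff P 0) * (\<Sum>k\<in>{0..<d}. coeff (pderiv P) k * ram_moment \<omega> P (k, i + 1))"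
      using i by (simp add: x_def scalar_prod_def sum_distrib_left sum_negf mult_ac)
    ultimately show "vec_index (?M *\<^sub>v x) i = vec_index (Matrix.vec d (\<lambda>_. 1)) i"
      using i by (simp flip: exp_add)
  qed (simp add: x_def)
  then have "?N = replace_col ?M (?M *\<^sub>v x) (j - 1)"
    by (intro eq_matI) (auto simp: replace_col_def)
  then have "Determinant.det ?N = vec_index x (j - 1) * ramificant d \<omega> P"
    unfolding ramificant_def using j d by (simp only:) (rule cramer_lemma_mat, auto simp: x_def)
  also have "vec_index x (j - 1) = - exp (- coeff P 0) * (of_nat j * coeff P j)"
    using j d by (cases j) (simp_all add: x_def coeff_pderiv)
  finally show ?thesis
    using j by (simp add: mpoly_eval_columns_det_poly)
qed

theorem mainTheorem17:
  fixes d j :: nat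
  assumes "d \<ge> 2" and "1 \<le> j" and "j \<le> d - 1"
  shows
    "(\<exists>N D :: mpoly2.
        mpoly_vars N \<subseteq> {0..d - 1} \<times> {1..d} \<and>
        mpoly_vars D \<subseteq> {0..d - 1} \<times> {1..d} \<and>
        (\<forall>\<omega> P. enumerates_roots_of_unity d \<omega> \<longrightarrow> normalized_poly d P \<longrightarrow>
           mpoly_eval (ram_moment \<omega> P) D \<noteq> 0 \<and>
           exp (- coeff P 0) * coeff P j =
             mpoly_eval (ram_moment \<omega> P) N / mpoly_eval (ram_moment \<omega> P) D)) \<and>
     (\<exists>Q :: mpoly2.
        mpoly_vars Q \<subseteq> {0..d - 1} \<times> {1..d} \<and>
        mpoly_total_degree Q = d - 1 \<and>
        (\<forall>\<omega> P. enumerates_roots_of_unity d \<omega> \<longrightarrow> normalized_poly d P \<longrightarrow>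
           ramificant d \<omega> P * exp (- coeff P 0) * coeff P j =
             mpoly_eval (ram_moment \<omega> P) Q))"
proof -
  define Q where "Q = columns_det_poly d ({0..<d} - {j - 1}) (- 1 / of_nat j)"
  define D where "D = columns_det_poly d {0..<d} 1"
  have D: "mpoly_eval (ram_moment \<omega> P) D = ramificant d \<omega> P" for \<omega> P
  proof -
    have "Matrix.mat d d (\<lambda>(i, k). if k \<in> {0..<d} then ram_moment \<omega> P (k, i + 1) else 1)
        = Matrix.mat d d (\<lambda>(i, k). ram_moment \<omega> P (k, i + 1))"
      by (intro eq_matI) auto
    then show ?thesis
      by (simp only: D_def mpoly_eval_columns_det_poly ramificant_def mult_1)
  qed
  have vars: "mpoly_vars Q \<subseteq> {0..d - 1} \<times> {1..d}" "mpoly_vars D \<subseteq> {0..d - 1} \<times> {1..d}"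
    unfolding Q_def D_def by (rule mpoly_vars_columns_det_poly)+
  have deg: "mpoly_total_degree Q = d - 1"
    unfolding Q_def using assms by (intro mpoly_total_degree_columns_det_poly) auto
  have eval: "ramificant d \<omega> P * exp (- coeff P 0) * coeff P j = mpoly_eval (ram_moment \<omega> P) Q"
    if "enumerates_roots_of_unity d \<omega>" "normalized_poly d P" for \<omega> P
    unfolding Q_def using assms that by (intro ramificant_mult_coeff) auto
  have quot: "mpoly_eval (ram_moment \<omega> P) D \<noteq> 0 \<and> exp (- coeff P 0) * coeff P j =
      mpoly_eval (ram_moment \<omega> P) Q / mpoly_eval (ram_moment \<omega> P) D"
    if "enumerates_roots_of_unity d \<omega>" "normalized_poly d P" for \<omega> P
    using ramificant_nonzero[OF assms(1) that] eval[OF that, symmetric]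
    by (simp add: D mult.assoc)
  show ?thesis
    using vars deg eval quot by blast
qed

end
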